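(* Let $\Bbbk$ be a field of characteristic $0$, let $\mathcal F$ be a unital associative $\Bbbk$-algebra, let $A=M_n(\Bbbk)$, and suppose that either $\mathfrak g=o(\Phi_0)$, or $n=2m$ and $\mathfrak g=o(\Phi_1)$. Then an invertible diagonal matrix $D=\mathrm{diag}(f_1,\dots,f_n)\in GL_n(\mathcal F)$ belongs to $G_{\mathfrak g,A}(\mathcal F)$ if and only if $$f_if_{n-i+1}-f_1f_n\in I_1(\mathcal F)=\mathcal F[\mathcal F,\mathcal F]\qquad\text{for } i=1,\dots,n.$$
   Context: $\Phi_0$ is the bilinear form on $\Bbbk^n$ given by $\Phi_0(x,y)=x_1y_n+x_2y_{n-1}+\dots+x_ny_1$. $\Phi_1$ is the bilinear form on $\Bbbk^{2m}$ given by $\Phi_1(x,y)=\sum_{i=1}^m x_iy_{2m+1-i}-\sum_{i=m+1}^{2m}x_iy_{2m+1-i}$. For a bilinear form $\Phi$ on $V=\Bbbk^n$, $o(\Phi)=\{M\in \mathrm{End}(V):\Phi(Mu,v)+\Phi(u,Mv)=0\ \forall u,v\in V\}$, a Lie subalgebra of $M_n(\Bbbk)$. $\mathcal F\otimes_{\Bbbk} M_n(\Bbbk)$ is identified with $M_n(\mathcal F)$. $(\mathfrak g,A)(\mathcal F)$ is the Lie subalgebra (commutator bracket) of $\mathcal F\otimes A=M_n(\mathcal F)$ generated by $\mathcal F\otimes\mathfrak g$, and $G_{\mathfrak g,A}(\mathcal F)=\{g\in GL_n(\mathcal F): g\cdot(\mathfrak g,A)(\mathcal F)\cdot g^{-1}=(\mathfrak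 g,A)(\mathcal F)\}$. $[\mathcal F,\mathcal F]$ is the linear span of all commutators in $\mathcal F$, and $\mathcal F[\mathcal F,\mathcal F]$ the linear span of products $f\cdot c$ with $f\in\mathcal F$, $c\in[\mathcal F,\mathcal F]$; it is the two-sided ideal of $\mathcal F$ generated by commutators. *)

theory Defs
  imports "Jordan_Normal_Form.Matrix"
begin

text \<open>The sort \<open>{ring, monoid_mult}\<close> means an associative ring with unit, in which
  \<open>1 = 0\<close> is not excluded (unlike in \<open>ring_1\<close>).\<close>

locale unital_assoc_algebra = vector_space scale
  for scale :: "'k::field \<Rightarrow> 'f::{ring,monoid_mult} \<Rightarrow> 'f" +
  assumes scale_mult_left: "scale c x * y = scale c (x * y)"
    and scale_mult_right: "x * scale c y = scale c (x * y)"

definition commutator_span :: "('k::field \<Rightarrow> 'f::{ring,monoid_mult} \<Rightarrow> 'f) \<Rightarrow> 'f set" where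
  "commutator_span scale = module.span scale {x * y - y * x | x y. True}"

definition I1 :: "('k::field \<Rightarrow> 'f::{ring,monoid_mult} \<Rightarrow> 'f) \<Rightarrow> 'f set" where
  "I1 scale = module.span scale {f * c | f c. c \<in> commutator_span scale}"

text \<open>Coordinates of vectors are indexed from 0 in the library, so \<open>x\<^sub>i\<close> is \<open>x $ (i - 1)\<close>
  and \<open>y\<^bsub>n+1-i\<^esub>\<close> is \<open>y $ (n - i)\<close>.\<close>

definition Phi0 :: "nat \<Rightarrow> 'k::field vec \<Rightarrow> 'k vec \<Rightarrow> 'k" where
  "Phi0 n x y = (\<Sum>i=1..n. x $ (i - 1) * y $ (n - i))"

definition Phi1 :: "nat \<Rightarrow> 'k::field vec \<Rightarrow> 'k vec \<Rightarrow> 'k" where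
  "Phi1 m x y = (\<Sum>i=1..m. x $ (i - 1) * y $ (2 * m - i))
              - (\<Sum>i=m+1..2*m. x $ (i - 1) * y $ (2 * m - i))"

definition lie_o :: "nat \<Rightarrow> ('k::field vec \<Rightarrow> 'k vec \<Rightarrow> 'k) \<Rightarrow> 'k mat set" where
  "lie_o n \<Phi> = {M \<in> carrier_mat n n.
     \<forall>u \<in> carrier_vec n. \<forall>v \<in> carrier_vec n. \<Phi> (M *\<^sub>v u) v + \<Phi> u (M *\<^sub>v v) = 0}"

definition mat_subspace ::
  "('k::field \<Rightarrow> 'f::{ring,monoid_mult} \<Rightarrow> 'f) \<Rightarrow> nat \<Rightarrow> 'f mat set \<Rightarrow> bool" where
  "mat_subspace scale n L \<longleftrightarrow> L \<subseteq> carrier_mat n n \<and> 0\<^sub>m n n \<in> L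
     \<and> (\<forall>X \<in> L. \<forall>Y \<in> L. X + Y \<in> L) \<and> (\<forall>c. \<forall>X \<in> L. map_mat (scale c) X \<in> L)"

definition mat_lie_subalgebra ::
  "('k::field \<Rightarrow> 'f::{ring,monoid_mult} \<Rightarrow> 'f) \<Rightarrow> nat \<Rightarrow> 'f mat set \<Rightarrow> bool" where
  "mat_lie_subalgebra scale n L \<longleftrightarrow>
     mat_subspace scale n L \<and> (\<forall>X \<in> L. \<forall>Y \<in> L. X * Y - Y * X \<in> L)"

text \<open>The pure tensor \<open>f \<otimes> M\<close> is identified with the matrix with entries
  \<open>M\<^sub>i\<^sub>j f\<close>.\<close>

definition pure_tensor ::
  "('k::field \<Rightarrow> 'f::{ring,monoid_mult} \<Rightarrow> 'f) \<Rightarrow> 'f \<Rightarrow> 'k mat \<Rightarrow> 'f mat" where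
  "pure_tensor scale f M = map_mat (\<lambda>a. scale a f) M"

definition F_tensor ::
  "('k::field \<Rightarrow> 'f::{ring,monoid_mult} \<Rightarrow> 'f) \<Rightarrow> nat \<Rightarrow> 'k mat set \<Rightarrow> 'f mat set" where
  "F_tensor scale n \<gg> = mat_subspace scale n hull {pure_tensor scale f M | f M. M \<in> \<gg>}"

definition lie_gA ::
  "('k::field \<Rightarrow> 'f::{ring,monoid_mult} \<Rightarrow> 'f) \<Rightarrow> nat \<Rightarrow> 'k mat set \<Rightarrow> 'f mat set" where
  "lie_gA scale n \<gg> = mat_lie_subalgebra scale n hull F_tensor scale n \<gg>"

text \<open>The library predicate \<open>invertible_mat\<close> needs entries in a \<open>semiring_1\<close>, which would exclude
  the zero algebra.\<close>

definition mutually_inverse :: "nat \<Rightarrow> 'f::{ring,monoid_mult} mat \<Rightarrow> 'f mat \<Rightarrow> bool" where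
  "mutually_inverse n g h \<longleftrightarrow> g \<in> carrier_mat n n \<and> h \<in> carrier_mat n n
     \<and> g * h = 1\<^sub>m n \<and> h * g = 1\<^sub>m n"

definition GL :: "nat \<Rightarrow> 'f::{ring,monoid_mult} mat set" where
  "GL n = {g. \<exists>h. mutually_inverse n g h}"

definition G_gA ::
  "('k::field \<Rightarrow> 'f::{ring,monoid_mult} \<Rightarrow> 'f) \<Rightarrow> nat \<Rightarrow> 'k mat set \<Rightarrow> 'f mat set" where
  "G_gA scale n \<gg> = {g \<in> GL n. \<exists>h. mutually_inverse n g h
     \<and> (\<lambda>X. g * X * h) ` lie_gA scale n \<gg> = lie_gA scale n \<gg>}"

end

theory Submission
  imports Defs
begin

text \<open>
  Write \<open>i'\<close> for the index opposite to \<open>i\<close>. Both forms have an antidiagonal matrix with signs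
  \<open>s\<^sub>i\<close>, and \<open>M\<close> lies in \<open>\<gg>\<close> iff \<open>M\<^sub>i\<^sub>j = - s\<^sub>i s\<^sub>j M\<^bsub>j'i'\<^esub>\<close>. Modulo the ideal \<open>I\<^sub>1\<close> the algebra is commutative,
  so the matrices over it with this antisymmetry modulo \<open>I\<^sub>1\<close> form a Lie algebra containing
  \<open>(\<gg>,A)(\<F>)\<close>. If \<open>D\<close> normalises \<open>(\<gg>,A)(\<F>)\<close>, the antisymmetry of
  \<open>D (E\<^sub>i\<^sub>j - s\<^sub>i s\<^sub>j E\<^bsub>j'i'\<^esub>) D\<^sup>-\<^sup>1\<close> modulo \<open>I\<^sub>1\<close> gives the congruences.

  Conversely, conjugation by \<open>D\<close> turns \<open>g (E\<^sub>i\<^sub>j - s\<^sub>i s\<^sub>j E\<^bsub>j'i'\<^esub>)\<close> into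
  \<open>a E\<^sub>i\<^sub>j - s\<^sub>i s\<^sub>j b E\<^bsub>j'i'\<^esub>\<close>, where \<open>a - b\<close> lies in \<open>I\<^sub>1\<close> by the congruences, and even in
  \<open>[\<F>,\<F>]\<close> if \<open>i = j\<close>. Brackets with \<open>f (E\<^sub>i\<^sub>i - E\<^bsub>i'i'\<^esub>)\<close> act on the two entries by
  multiplication from different sides, which produces \<open>c E\<^bsub>j'i'\<^esub>\<close> in \<open>(\<gg>,A)(\<F>)\<close> for all
  \<open>c \<in> I\<^sub>1\<close> when \<open>j \<noteq> i, i'\<close>, and \<open>c (E\<^sub>i\<^sub>i + E\<^bsub>i'i'\<^esub>)\<close> for all \<open>c \<in> [\<F>,\<F>]\<close>. The description
  of \<open>(\<gg>,A)(\<F>)\<close> as a whole is not needed.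
\<close>

section \<open>Products with diagonal matrices and their inverses\<close>

lemma index_mult_mat_sum:
  fixes X Y :: "'a::semiring_0 mat"
  assumes "X \<in> carrier_mat n n" "Y \<in> carrier_mat n n" "i < n" "j < n"
  shows "(X * Y) $$ (i,j) = (\<Sum>k<n. X $$ (i,k) * Y $$ (k,j))"
  using assms by (auto simp: scalar_prod_def lessThan_atLeast0)

lemma mat_diag_conj:
  fixes X :: "'a::semiring_0 mat"
  assumes "X \<in> carrier_mat n n"
  shows "mat_diag n d * X * mat_diag n e = mat n n (\<lambda>(i,j). d i * X $$ (i,j) * e j)"
proof -
  have "mat_diag n d * X \<in> carrier_mat n n"
    using assms by (simp add: mat_diag_mult_left)
  then show ?thesis
    using assms by (subst mat_diag_mult_right[of _ n]) (auto simp: mat_diag_mult_left)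
qed

lemma mat_diag_commutator:
  fixes X :: "'a::ring mat"
  assumes "X \<in> carrier_mat n n"
  shows "mat_diag n d * X - X * mat_diag n d
    = mat n n (\<lambda>(i,j). d i * X $$ (i,j) - X $$ (i,j) * d j)"
  using assms by (intro eq_matI) (auto simp: mat_diag_mult_left mat_diag_mult_right)

text \<open>An inverse of a diagonal matrix is diagonal: \<open>h $$ (i,i)\<close> is a left inverse
  of \<open>d i\<close>, and cancelling \<open>d i\<close> in \<open>d i * h $$ (i,j) = 0\<close>
  kills the off-diagonal entries.\<close>

lemma mutually_inverse_mat_diagE:
  fixes d :: "nat \<Rightarrow> 'f::{ring,monoid_mult}"
  assumes "mutually_inverse n (mat_diag n d) h"
  obtains e where "h = mat_diag n e" "\<forall>i<n. d i * e i = 1 \<and> e i * d i = 1"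
proof -
  have h: "h \<in> carrier_mat n n" and dh: "mat_diag n d * h = 1\<^sub>m n" and hd: "h * mat_diag n d = 1\<^sub>m n"
    using assms by (auto simp: mutually_inverse_def)
  have l: "d i * h $$ (i,j) = (if i = j then 1 else 0)" if "i < n" "j < n" for i j
    using arg_cong[OF dh, of "\<lambda>A. A $$ (i,j)"] that h by (simp add: mat_diag_mult_left)
  have r: "h $$ (i,j) * d j = (if i = j then 1 else 0)" if "i < n" "j < n" for i j
    using arg_cong[OF hd, of "\<lambda>A. A $$ (i,j)"] that h by (simp add: mat_diag_mult_right)
  have z: "h $$ (i,j) = 0" if "i < n" "j < n" "i \<noteq> j" for i j
  proof -
    have "h $$ (i,j) = h $$ (i,i) * d i * h $$ (i,j)"
      using r[of i i] that by simp
    also have "\<dots> = 0"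
      using l[of i j] that by (simp add: mult.assoc)
    finally show ?thesis .
  qed
  have "h = mat_diag n (\<lambda>i. h $$ (i,i))"
    using h z by (intro eq_matI) (auto simp: mat_diag_def)
  then show ?thesis
    using that l r by auto
qed

section \<open>Generated subspaces and Lie algebras of matrices\<close>

context unital_assoc_algebra
begin

lemma scale_times: "scale a x * scale b y = scale (a * b) (x * y)"
  by (simp add: scale_mult_left scale_mult_right mult.commute)

lemma mat_subspace_carrier: "mat_subspace scale n (carrier_mat n n)"
  by (auto simp: mat_subspace_def)

lemma mat_lie_subalgebra_carrier: "mat_lie_subalgebra scale n (carrier_mat n n)"
  by (auto simp: mat_lie_subalgebra_def mat_subspace_carrier minus_carrier_mat)

text \<open>The empty family is excluded because its intersection is the whole type, which exceeds
  \<open>carrier_mat n n\<close>.\<close>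

lemma mat_subspace_Inter:
  "T \<noteq> {} \<Longrightarrow> (\<And>t. t \<in> T \<Longrightarrow> mat_subspace scale n t) \<Longrightarrow> mat_subspace scale n (\<Inter>T)"
  unfolding mat_subspace_def by (intro conjI) (blast+)

lemma mat_lie_subalgebra_Inter:
  "T \<noteq> {} \<Longrightarrow> (\<And>t. t \<in> T \<Longrightarrow> mat_lie_subalgebra scale n t) \<Longrightarrow> mat_lie_subalgebra scale n (\<Inter>T)"
  unfolding mat_lie_subalgebra_def
  by (intro conjI mat_subspace_Inter) blast+

lemma mat_subspace_F_tensor:
  assumes "\<gg> \<subseteq> carrier_mat n n"
  shows "mat_subspace scale n (F_tensor scale n \<gg>)"
  unfolding F_tensor_def hull_def
proof (rule mat_subspace_Inter)
  show "{t. mat_subspace scale n t \<and> {pure_tensor scale f M |f M. M \<in> \<gg>} \<subseteq> t} \<noteq> {}"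
    using assms mat_subspace_carrier[of n] by (auto simp: pure_tensor_def intro!: exI[of _ "carrier_mat n n"])
qed auto

lemma mat_lie_subalgebra_lie_gA:
  assumes "\<gg> \<subseteq> carrier_mat n n"
  shows "mat_lie_subalgebra scale n (lie_gA scale n \<gg>)"
  unfolding lie_gA_def hull_def
proof (rule mat_lie_subalgebra_Inter)
  have "F_tensor scale n \<gg> \<subseteq> carrier_mat n n"
    using mat_subspace_F_tensor[OF assms] by (simp add: mat_subspace_def)
  then show "{t. mat_lie_subalgebra scale n t \<and> F_tensor scale n \<gg> \<subseteq> t} \<noteq> {}"
    using mat_lie_subalgebra_carrier by blast
qed auto

lemma pure_tensor_in_lie_gA: "M \<in> \<gg> \<Longrightarrow> pure_tensor scale f M \<in> lie_gA scale n \<gg>"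
  unfolding lie_gA_def F_tensor_def by (intro hull_inc) blast

text \<open>Induction principle for \<open>lie_gA\<close>: a Lie subalgebra is also a subspace, so
  checking pure tensors bounds both hulls.\<close>

lemma lie_gA_least:
  assumes "mat_lie_subalgebra scale n T" "\<And>f M. M \<in> \<gg> \<Longrightarrow> pure_tensor scale f M \<in> T"
  shows "lie_gA scale n \<gg> \<subseteq> T"
  unfolding lie_gA_def F_tensor_def using assms
  by (intro hull_minimal) (auto simp: mat_lie_subalgebra_def)

text \<open>The zero matrix depends on the size, so the sum is formed entry by entry at a fixed
  size.\<close>

lemma mat_subspace_sum:
  assumes L: "mat_subspace scale n L" and "finite S" and "\<And>s. s \<in> S \<Longrightarrow> G s \<in> L"
  shows "mat n n (\<lambda>p. \<Sum>s\<in>S. G s $$ p) \<in> L"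
  using assms(2,3)
proof (induction S rule: finite_induct)
  case empty
  show ?case
    using L by (simp add: mat_subspace_def zero_mat_def)
next
  case (insert x S)
  have "G x + mat n n (\<lambda>p. \<Sum>s\<in>S. G s $$ p) \<in> L" and "G x \<in> carrier_mat n n"
    using insert L unfolding mat_subspace_def by auto
  moreover have "G x + mat n n (\<lambda>p. \<Sum>s\<in>S. G s $$ p) = mat n n (\<lambda>p. \<Sum>s\<in>insert x S. G s $$ p)"
    using insert \<open>G x \<in> carrier_mat n n\<close> by (intro eq_matI) auto
  ultimately show ?case by simp
qed

text \<open>Since \<open>H * D\<close> is the identity, conjugation respects brackets. The preimage
  \<open>?T\<close> of the Lie algebra is thus a Lie subalgebra, and only generators have to be
  checked.\<close>

lemma conj_lie_gA_subset:
  assumes g: "\<gg> \<subseteq> carrier_mat n n" and inv: "mutually_inverse n D H"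
    and gen: "\<And>f M. M \<in> \<gg> \<Longrightarrow> D * pure_tensor scale f M * H \<in> lie_gA scale n \<gg>"
  shows "(\<lambda>X. D * X * H) ` lie_gA scale n \<gg> \<subseteq> lie_gA scale n \<gg>"
proof -
  let ?L = "lie_gA scale n \<gg>"
  let ?T = "{X \<in> carrier_mat n n. D * X * H \<in> ?L}"
  have D: "D \<in> carrier_mat n n" and H: "H \<in> carrier_mat n n" and HD: "H * D = 1\<^sub>m n"
    using inv by (auto simp: mutually_inverse_def)
  have L: "mat_lie_subalgebra scale n ?L"
    by (rule mat_lie_subalgebra_lie_gA[OF g])
  then have Ls: "mat_subspace scale n ?L"
    by (simp add: mat_lie_subalgebra_def)
  \<comment> \<open>The identity is treated as a diagonal matrix: \<open>'f\<close> may be the zero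
    ring, so it is not a \<open>semiring_1\<close>.\<close>
  have one: "1\<^sub>m n * X = X" if "X \<in> carrier_mat n n" for X :: "'f mat"
    unfolding mat_diag_one[symmetric] using that
    by (subst mat_diag_mult_left[of _ n n]) auto
  have mult: "D * (X * Y) * H = (D * X * H) * (D * Y * H)"
    if "X \<in> carrier_mat n n" "Y \<in> carrier_mat n n" for X Y
  proof -
    have "(D * X * H) * (D * Y * H) = D * X * ((H * D) * (Y * H))"
      using that D H by (simp add: assoc_mult_mat[of _ n n _ n _ n])
    also have "\<dots> = D * (X * Y) * H"
      unfolding HD using that D H
      by (simp add: one assoc_mult_mat[of _ n n _ n _ n])
    finally show ?thesis by simp
  qed
  have add: "D * (X + Y) * H = D * X * H + D * Y * H"
    if "X \<in> carrier_mat n n" "Y \<in> carrier_mat n n" for X Y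
    using that D H by (simp add: mult_add_distrib_mat[of _ n n] add_mult_distrib_mat[of _ n n])
  have diff: "D * (X - Y) * H = D * X * H - D * Y * H"
    if "X \<in> carrier_mat n n" "Y \<in> carrier_mat n n" for X Y
    using that D H by (simp add: mult_minus_distrib_mat[of _ n n] minus_mult_distrib_mat[of _ n n])
  have scl: "D * map_mat (scale c) X * H = map_mat (scale c) (D * X * H)"
    if "X \<in> carrier_mat n n" for X c
  proof -
    have "D * map_mat (scale c) X = map_mat (scale c) (D * X)"
      using that D by (intro eq_matI) (auto simp: scalar_prod_def scale_sum_right scale_mult_right)
    moreover have "map_mat (scale c) (D * X) * H = map_mat (scale c) (D * X * H)"
      using that D H by (intro eq_matI) (auto simp: scalar_prod_def scale_sum_right[symmetric] scale_mult_left simp del: assoc_mult_mat)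
    ultimately show ?thesis by simp
  qed
  have zero: "D * 0\<^sub>m n n * H = 0\<^sub>m n n"
    using D H by simp
  have "mat_lie_subalgebra scale n ?T"
    unfolding mat_lie_subalgebra_def mat_subspace_def
  proof (intro conjI ballI allI)
    show "0\<^sub>m n n \<in> ?T"
      using zero Ls by (simp add: mat_subspace_def)
    fix X Y assume X: "X \<in> ?T" and Y: "Y \<in> ?T"
    show "X + Y \<in> ?T"
      using X Y Ls by (auto simp: add mat_subspace_def)
    show "X * Y - Y * X \<in> ?T"
      using X Y L by (auto simp: diff mult mat_lie_subalgebra_def minus_carrier_mat)
  next
    fix c X assume X: "X \<in> ?T"
    show "map_mat (scale c) X \<in> ?T"
      using X Ls by (auto simp: scl mat_subspace_def)
  qed auto
  moreover have "pure_tensor scale f M \<in> ?T" if "M \<in> \<gg>" for f M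
    using gen[OF that] g that by (auto simp: pure_tensor_def)
  ultimately have "?L \<subseteq> ?T"
    by (rule lie_gA_least)
  then show ?thesis by auto
qed

section \<open>The commutator ideal and congruence modulo it\<close>

lemma commutator_in_commutator_span: "x * y - y * x \<in> commutator_span scale"
  unfolding commutator_span_def by (intro span_base) blast

lemma commutator_span_subspace: "subspace (commutator_span scale)"
  by (simp add: commutator_span_def)

lemma I1_subspace: "subspace (I1 scale)"
  by (simp add: I1_def)

lemma mult_commutator_span_in_I1: "c \<in> commutator_span scale \<Longrightarrow> f * c \<in> I1 scale"
  unfolding I1_def by (intro span_base) blast

lemma commutator_in_I1: "x * y - y * x \<in> I1 scale"
  using mult_commutator_span_in_I1[OF commutator_in_commutator_span, of 1] by simp

lemma I1_mult_left:
  assumes "x \<in> I1 scale" shows "f * x \<in> I1 scale"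
  using assms unfolding I1_def
proof (induction rule: span_induct)
  case base
  show ?case
    by (auto simp: subspace_def distrib_left scale_mult_right intro: span_zero span_add span_scale)
next
  case (step x)
  then obtain g c where "x = g * c" "c \<in> commutator_span scale" by blast
  then show ?case
    using mult_commutator_span_in_I1[of c "f * g"] by (simp add: mult.assoc I1_def)
qed

text \<open>\<open>x * f\<close> and \<open>f * x\<close> differ by a commutator, so the left ideal
  is two-sided.\<close>

lemma I1_mult_right:
  assumes "x \<in> I1 scale" shows "x * f \<in> I1 scale"
proof -
  have "f * x + (x * f - f * x) \<in> I1 scale"
    by (intro subspace_add I1_subspace I1_mult_left assms commutator_in_I1)
  then show ?thesis by simp
qed

text \<open>Equality in the commutative quotient by \<open>I1\<close>, expressed on
  representatives.\<close>

definition I1_cong :: "'f \<Rightarrow> 'f \<Rightarrow> bool" (infix \<open>\<simeq>\<close> 50) where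
  "x \<simeq> y \<longleftrightarrow> x - y \<in> I1 scale"

lemma I1_cong_refl [simp]: "x \<simeq> x"
  using subspace_0[OF I1_subspace] by (simp add: I1_cong_def)

lemma I1_cong_sym: "x \<simeq> y \<Longrightarrow> y \<simeq> x"
  using subspace_neg[OF I1_subspace, of "x - y"] by (simp add: I1_cong_def)

lemma I1_cong_trans [trans]: "x \<simeq> y \<Longrightarrow> y \<simeq> z \<Longrightarrow> x \<simeq> z"
  using subspace_add[OF I1_subspace, of "x - y" "y - z"] by (simp add: I1_cong_def)

lemma I1_cong_comm: "x * y \<simeq> y * x"
  by (simp add: I1_cong_def commutator_in_I1)

lemma I1_cong_mult:
  assumes "x \<simeq> x'" "y \<simeq> y'"
  shows "x * y \<simeq> x' * y'"
proof -
  have "x * (y - y') + (x - x') * y' \<in> I1 scale"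
    using assms by (intro subspace_add I1_subspace I1_mult_left I1_mult_right) (simp_all add: I1_cong_def)
  then show ?thesis
    by (simp add: I1_cong_def algebra_simps)
qed

lemma I1_cong_scale: "x \<simeq> y \<Longrightarrow> scale c x \<simeq> scale c y"
  using subspace_scale[OF I1_subspace, of "x - y" c] by (simp add: I1_cong_def scale_right_diff_distrib)

lemma I1_cong_add:
  assumes "x \<simeq> x'" "y \<simeq> y'"
  shows "x + y \<simeq> x' + y'"
  using subspace_add[OF I1_subspace, of "x - x'" "y - y'"] assms
  by (simp add: I1_cong_def algebra_simps)

lemma I1_cong_diff:
  assumes "x \<simeq> x'" "y \<simeq> y'"
  shows "x - y \<simeq> x' - y'"
  using subspace_diff[OF I1_subspace, of "x - x'" "y - y'"] assms
  by (simp add: I1_cong_def algebra_simps)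

lemma I1_cong_sum: "(\<And>i. i \<in> A \<Longrightarrow> g i \<simeq> h i) \<Longrightarrow> sum g A \<simeq> sum h A"
  using subspace_sum[OF I1_subspace, of A "\<lambda>i. g i - h i"] by (simp add: I1_cong_def sum_subtractf)

end

text \<open>The map \<open>i \<mapsto> n + 1 - i\<close> of the paper, for indices starting at 0.\<close>

definition opp :: "nat \<Rightarrow> nat \<Rightarrow> nat" where
  "opp n i = n - Suc i"

lemma opp_less [simp]: "i < n \<Longrightarrow> opp n i < n"
  and opp_opp [simp]: "i < n \<Longrightarrow> opp n (opp n i) = i"
  by (auto simp: opp_def)

lemma opp_eq_iff: "i < n \<Longrightarrow> j < n \<Longrightarrow> i = opp n j \<longleftrightarrow> j = opp n i"
  by (auto simp: opp_def)

lemma sum_opp: "(\<Sum>i<n. g (opp n i)) = (\<Sum>i<n. g i)"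
  by (rule sum.reindex_bij_witness[of _ "opp n" "opp n"]) auto

section \<open>Both bilinear forms as signed antidiagonal forms\<close>

definition antidiag_form :: "nat \<Rightarrow> (nat \<Rightarrow> 'k::field) \<Rightarrow> 'k vec \<Rightarrow> 'k vec \<Rightarrow> 'k" where
  "antidiag_form n s x y = (\<Sum>i<n. s i * (x $ i * y $ opp n i))"

lemma Phi0_eq_antidiag_form: "Phi0 n = antidiag_form n (\<lambda>_. 1)"
  by (intro ext) (simp add: Phi0_def antidiag_form_def sum.atLeast1_atMost_eq opp_def)

lemma Phi1_eq_antidiag_form: "Phi1 m = antidiag_form (2 * m) (\<lambda>i. if i < m then 1 else - 1)"
proof (intro ext)
  fix x y :: "'a vec"
  \<comment> \<open>With indices from 1 the sign is positive for \<open>i \<le> m\<close>; the shift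
    to indices from 0 turns this into \<open>i < m\<close>.\<close>
  let ?g = "\<lambda>i. (if i \<le> m then 1 else - 1) * (x $ (i - 1) * y $ (2 * m - i))"
  have "Phi1 m x y = sum ?g {1..m} + sum ?g {m+1..2*m}"
    by (simp add: Phi1_def sum_negf)
  also have "\<dots> = sum ?g ({1..m} \<union> {m+1..2*m})"
    by (rule sum.union_disjoint[symmetric]) auto
  also have "{1..m} \<union> {m+1..2*m} = {Suc 0..2*m}" by auto
  also have "sum ?g {Suc 0..2*m} = antidiag_form (2 * m) (\<lambda>i. if i < m then 1 else - 1) x y"
    by (simp add: antidiag_form_def sum.atLeast1_atMost_eq opp_def Suc_le_eq)
  finally show "Phi1 m x y = antidiag_form (2 * m) (\<lambda>i. if i < m then 1 else - 1) x y" .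
qed

section \<open>The Lie algebra of a signed antidiagonal form\<close>

text \<open>All signs are 1 or -1, and \<open>s_opp\<close> says that passing to opposite indices
  keeps every sign or flips every sign. This treats the symmetric and the alternating form
  together.\<close>

locale signed_antidiag = unital_assoc_algebra scale
  for scale :: "'k::field_char_0 \<Rightarrow> 'f::{ring,monoid_mult} \<Rightarrow> 'f" +
  fixes n :: nat and s :: "nat \<Rightarrow> 'k"
  assumes s_sq: "i < n \<Longrightarrow> s i * s i = 1"
    and s_opp: "i < n \<Longrightarrow> j < n \<Longrightarrow> s (opp n i) * s (opp n j) = s i * s j"
begin

abbreviation r :: "nat \<Rightarrow> nat" where "r \<equiv> opp n"

abbreviation \<epsilon> :: "nat \<Rightarrow> nat \<Rightarrow> 'k" where "\<epsilon> i j \<equiv> s i * s j"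

abbreviation \<oo> :: "'k mat set" where "\<oo> \<equiv> lie_o n (antidiag_form n s)"

abbreviation L :: "'f mat set" where "L \<equiv> lie_gA scale n \<oo>"

lemma eps_sq: "i < n \<Longrightarrow> j < n \<Longrightarrow> \<epsilon> i j * \<epsilon> i j = 1"
  using s_sq[of i] s_sq[of j] by (metis mult.left_commute mult.assoc mult_1)

lemma eps_opp: "i < n \<Longrightarrow> j < n \<Longrightarrow> \<epsilon> (r j) (r i) = \<epsilon> i j"
  using s_opp[of j i] by (simp add: mult.commute)

lemma mem_o_iff:
  "M \<in> \<oo> \<longleftrightarrow> M \<in> carrier_mat n n \<and> (\<forall>i<n. \<forall>j<n. M $$ (i,j) = - (\<epsilon> i j * M $$ (r j, r i)))"
proof (cases "M \<in> carrier_mat n n")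
  case M: True
  let ?\<Phi> = "antidiag_form n s"
  let ?c = "\<lambda>i j. s (r j) * M $$ (r j, i) + s i * M $$ (r i, j)"
  \<comment> \<open>The invariance condition is bilinear in \<open>u\<close> and \<open>v\<close>;
    \<open>?c i j\<close> is its coefficient at \<open>u $ i * v $ j\<close>, found by reindexing
    the first sum with \<open>opp\<close>.\<close>
  have expand: "?\<Phi> (M *\<^sub>v u) v + ?\<Phi> u (M *\<^sub>v v) = (\<Sum>i<n. \<Sum>j<n. ?c i j * (u $ i * v $ j))"
    if "u \<in> carrier_vec n" "v \<in> carrier_vec n" for u v
  proof -
    have "?\<Phi> (M *\<^sub>v u) v = (\<Sum>j<n. \<Sum>i<n. s j * M $$ (j,i) * (u $ i * v $ r j))"
      using M that
      by (auto simp: antidiag_form_def scalar_prod_def sum_distrib_left sum_distrib_right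
          lessThan_atLeast0 ac_simps intro!: sum.cong)
    also have "\<dots> = (\<Sum>j<n. \<Sum>i<n. s (r j) * M $$ (r j,i) * (u $ i * v $ j))"
      by (subst sum_opp[symmetric]) (auto intro!: sum.cong)
    also have "\<dots> = (\<Sum>i<n. \<Sum>j<n. s (r j) * M $$ (r j,i) * (u $ i * v $ j))"
      by (rule sum.swap)
    finally have 1: "?\<Phi> (M *\<^sub>v u) v = (\<Sum>i<n. \<Sum>j<n. s (r j) * M $$ (r j,i) * (u $ i * v $ j))" .
    have 2: "?\<Phi> u (M *\<^sub>v v) = (\<Sum>i<n. \<Sum>j<n. s i * M $$ (r i,j) * (u $ i * v $ j))"
      using M that
      by (auto simp: antidiag_form_def scalar_prod_def sum_distrib_left sum_distrib_right
          lessThan_atLeast0 ac_simps intro!: sum.cong)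
    show ?thesis
      unfolding 1 2 by (simp add: sum.distrib[symmetric] distrib_right)
  qed
  \<comment> \<open>Multiplying by the unit \<open>s (r j)\<close> turns the vanishing of a
    coefficient into the antisymmetry at position \<open>(r j, i)\<close>.\<close>
  have c: "?c i j = 0 \<longleftrightarrow> M $$ (r j, i) = - (\<epsilon> (r j) i * M $$ (r i, r (r j)))"
    if "i < n" "j < n" for i j
  proof -
    have "s (r j) * ?c i j = M $$ (r j, i) + \<epsilon> (r j) i * M $$ (r i, j)"
      using s_sq[of "r j"] that by (simp add: distrib_left mult.assoc[symmetric])
    moreover have "s (r j) \<noteq> 0"
      using s_sq[of "r j"] that by auto
    ultimately show ?thesis
      using that by (metis add_eq_0_iff2 mult_eq_0_iff opp_opp)
  qed
  show ?thesis
  proof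
    assume o: "M \<in> \<oo>"
    \<comment> \<open>Unit vectors isolate a single coefficient.\<close>
    have c0: "?c i j = 0" if "i < n" "j < n" for i j
    proof -
      have "0 = (\<Sum>i'<n. \<Sum>j'<n. ?c i' j' * (unit_vec n i $ i' * unit_vec n j $ j'))"
        using o that by (subst expand[symmetric]) (auto simp: lie_o_def)
      also have "\<dots> = (\<Sum>i'<n. \<Sum>j'<n. if i' = i then if j' = j then ?c i j else 0 else 0)"
        using that by (intro sum.cong) (auto simp: unit_vec_def)
      also have "\<dots> = (\<Sum>i'<n. if i' = i then \<Sum>j'<n. if j' = j then ?c i j else 0 else 0)"
        by (intro sum.cong) auto
      also have "\<dots> = ?c i j"
        using that by simp
      finally show ?thesis by simp
    qed
    have "M $$ (i,j) = - (\<epsilon> i j * M $$ (r j, r i))" if "i < n" "j < n" for i j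
      using c0[of j "r i"] c[of j "r i"] that by simp
    with M show "M \<in> carrier_mat n n \<and> (\<forall>i<n. \<forall>j<n. M $$ (i,j) = - (\<epsilon> i j * M $$ (r j, r i)))"
      by blast
  next
    assume R: "M \<in> carrier_mat n n \<and> (\<forall>i<n. \<forall>j<n. M $$ (i,j) = - (\<epsilon> i j * M $$ (r j, r i)))"
    have "?c i j = 0" if "i < n" "j < n" for i j
      unfolding c[OF that] using R opp_less[OF that(2)] that(1) by blast
    then show "M \<in> \<oo>"
      using M by (simp add: lie_o_def expand)
  qed
qed (simp add: lie_o_def)

lemma o_carrier: "\<oo> \<subseteq> carrier_mat n n"
  by (auto simp: lie_o_def)

text \<open>The positions \<open>(i,j)\<close> and \<open>(r j, r i)\<close> may coincide (when \<open>j = r i\<close>); then the two entries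
  add up.\<close>

definition W :: "nat \<Rightarrow> nat \<Rightarrow> 'a::comm_monoid_add \<Rightarrow> 'a \<Rightarrow> 'a mat" where
  "W i j a b = mat n n (\<lambda>(p,q). (if p = i \<and> q = j then a else 0) + (if p = r j \<and> q = r i then b else 0))"

section \<open>Matrices with two opposite entries, and their brackets\<close>

text \<open>For \<open>j = r i\<close> the two entries merge into \<open>1 - \<epsilon> i j\<close>,
  and antisymmetry holds because \<open>\<epsilon> i j\<close> squares to 1.\<close>

lemma W_in_o: "i < n \<Longrightarrow> j < n \<Longrightarrow> W i j 1 (- \<epsilon> i j) \<in> \<oo>"
  unfolding mem_o_iff
  by (auto simp: W_def eps_sq eps_opp right_diff_distrib opp_eq_iff[of i]
      dest: opp_eq_iff[THEN iffD1, rotated 2])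

lemma L_lie: "mat_lie_subalgebra scale n L"
  by (rule mat_lie_subalgebra_lie_gA[OF o_carrier])

lemma L_subspace: "mat_subspace scale n L"
  using L_lie by (simp add: mat_lie_subalgebra_def)

lemma W_carrier [simp]: "W i j a b \<in> carrier_mat n n"
  by (simp add: W_def)

lemma W_zero_in_L: "W i j 0 0 \<in> L"
proof -
  have "W i j 0 0 = (0\<^sub>m n n :: 'f mat)"
    by (intro eq_matI) (auto simp: W_def)
  then show ?thesis
    using L_subspace by (simp add: mat_subspace_def)
qed

lemma W_add_in_L:
  assumes "W i j a b \<in> L" "W i j a' b' \<in> L"
  shows "W i j (a + a') (b + b') \<in> L"
proof -
  have entry: "(if P then a + a' else 0) + (if Q then b + b' else 0)
    = ((if P then a else 0) + (if Q then b else 0)) + ((if P then a' else 0) + (if Q then b' else 0))"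
    for P Q by simp
  have "W i j (a + a') (b + b') = W i j a b + W i j a' b'"
    unfolding W_def entry by (intro eq_matI) simp_all
  then show ?thesis
    using assms L_subspace unfolding mat_subspace_def by simp
qed

lemma W_scale_in_L:
  assumes "W i j a b \<in> L"
  shows "W i j (scale c a) (scale c b) \<in> L"
proof -
  have entry: "(if P then scale c a else 0) + (if Q then scale c b else 0)
    = scale c ((if P then a else 0) + (if Q then b else 0))" for P Q
    by (simp add: scale_right_distrib)
  have "W i j (scale c a) (scale c b) = map_mat (scale c) (W i j a b)"
    unfolding W_def entry by (intro eq_matI) simp_all
  then show ?thesis
    using assms L_subspace unfolding mat_subspace_def by simp
qed

lemma W_antisym_in_L:
  assumes "i < n" "j < n"
  shows "W i j a (scale (- \<epsilon> i j) a) \<in> L"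
proof -
  have entry: "(if P then a else 0) + (if Q then scale (- \<epsilon> i j) a else 0)
    = scale ((if P then 1 else 0) + (if Q then - \<epsilon> i j else 0)) a" for P Q
    by (simp add: scale_left_distrib)
  have "W i j a (scale (- \<epsilon> i j) a) = pure_tensor scale a (W i j 1 (- \<epsilon> i j))"
    unfolding W_def pure_tensor_def entry by (intro eq_matI) simp_all
  then show ?thesis
    using pure_tensor_in_lie_gA[OF W_in_o[OF assms]] by simp
qed

text \<open>A commutator with a diagonal matrix multiplies each entry on the left by its row weight
  and on the right by its column weight. For \<open>i = r i\<close> the two weights would cancel in
  \<open>W i i\<close>, hence the assumption.\<close>

lemma W_bracket_in_L:
  fixes f
  defines "\<delta> i k \<equiv> if k = i then f else if k = r i then - f else 0"
  assumes i: "i < n" "i \<noteq> r i" and W: "W p q a b \<in> L"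
  shows "W p q (\<delta> i p * a - a * \<delta> i q) (\<delta> i (r q) * b - b * \<delta> i (r p)) \<in> L"
proof -
  have "mat_diag n (\<delta> i) = W i i f (scale (- \<epsilon> i i) f)"
    using i by (intro eq_matI) (auto simp: W_def mat_diag_def \<delta>_def s_sq)
  then have "mat_diag n (\<delta> i) \<in> L"
    using W_antisym_in_L[OF i(1) i(1)] by simp
  then have comm: "mat_diag n (\<delta> i) * W p q a b - W p q a b * mat_diag n (\<delta> i) \<in> L"
    using W by (rule L_lie[unfolded mat_lie_subalgebra_def, THEN conjunct2, rule_format])
  \<comment> \<open>\<open>P\<close> and \<open>Q\<close> may hold together, which covers coinciding
    positions.\<close>
  have entry: "x * ((if P then a else 0) + (if Q then b else 0))
      - ((if P then a else 0) + (if Q then b else 0)) * y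
    = (if P then x1 * a - a * y1 else 0) + (if Q then x2 * b - b * y2 else 0)"
    if "P \<Longrightarrow> x = x1 \<and> y = y1" "Q \<Longrightarrow> x = x2 \<and> y = y2" for P Q x y x1 x2 y1 y2
    using that by (cases P; cases Q) (simp_all add: distrib_left distrib_right)
  have "mat_diag n (\<delta> i) * W p q a b - W p q a b * mat_diag n (\<delta> i)
    = W p q (\<delta> i p * a - a * \<delta> i q) (\<delta> i (r q) * b - b * \<delta> i (r p))"
    unfolding mat_diag_commutator[OF W_carrier]
  proof (rule eq_matI, goal_cases)
    case (1 k l)
    then have kl: "k < n" "l < n" by (auto simp: W_def)
    show ?case
      unfolding W_def index_mat(1)[OF kl] prod.case by (rule entry) blast+
  qed (simp_all add: W_def)
  with comm show ?thesis by simp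
qed

section \<open>Commutators and elements of \<open>I1\<close> as entries\<close>

text \<open>In the bracket of \<open>f\<close> and \<open>a\<close> on the diagonal, the two minus
  signs at the opposite position cancel, so both entries become the same commutator.\<close>

lemma W_commutator_span_in_L:
  assumes i: "i < n" "i \<noteq> r i" and "c \<in> commutator_span scale"
  shows "W i i c c \<in> L"
  using assms(3) unfolding commutator_span_def
proof (induction rule: span_induct)
  case base
  show ?case
    by (auto simp: subspace_def W_zero_in_L W_add_in_L W_scale_in_L)
next
  case (step c)
  then obtain f a where c: "c = f * a - a * f" by blast
  have "W i i (f * a - a * f) (- f * - a - - a * - f) \<in> L"
    using W_bracket_in_L[OF i W_antisym_in_L[OF i(1) i(1), of a], of f] i by (simp add: s_sq)
  then show ?case
    by (simp add: c)
qed

text \<open>Bracket with \<open>f (E\<^sub>i\<^sub>i - E\<^bsub>i'i'\<^esub>)\<close> in the first case; this matrix vanishes when \<open>i\<close> is the middle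
  index, and then \<open>f (E\<^sub>j\<^sub>j - E\<^bsub>j'j'\<^esub>)\<close> gives the second case.\<close>

lemma W_0_mult_in_L:
  assumes ij: "i < n" "j < n" "i \<noteq> j" "j \<noteq> r i"
  shows "(\<forall>a b. W i j a b \<in> L \<longrightarrow> W i j (f * a) (b * f) \<in> L) \<or>
    (\<forall>a b. W i j a b \<in> L \<longrightarrow> W i j (a * f) (f * b) \<in> L)"
proof -
  have ne: "i \<noteq> r j" "r i \<noteq> r j" "r j \<noteq> r i" "r i \<noteq> j"
    using ij by (auto simp: opp_def)
  show ?thesis
  proof (cases "i = r i")
    case False
    have "W i j (f * a) (b * f) \<in> L" if "W i j a b \<in> L" for a b
      using W_bracket_in_L[OF ij(1) False that, of f] ij ne False by simp
    then show ?thesis by blast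
  next
    case True
    with ij have j: "j \<noteq> r j"
      by (auto simp: opp_def)
    have "W i j (a * f) (f * b) \<in> L" if "W i j a b \<in> L" for a b
    proof -
      have "W i j (- (a * f)) (- (f * b)) \<in> L"
        using W_bracket_in_L[OF ij(2) j that, of f] ij ne j True by simp
      from W_scale_in_L[OF this, of "-1"] show ?thesis by simp
    qed
    then show ?thesis by blast
  qed
qed

text \<open>Multiplying the two entries of an antisymmetric \<open>W\<close> from opposite sides and
  subtracting the antisymmetric \<open>W\<close> with the same first entry leaves a multiple of a
  commutator in second place.\<close>

lemma W_0_commutator_span_in_L:
  assumes ij: "i < n" "j < n" "i \<noteq> j" "j \<noteq> r i" and "c \<in> commutator_span scale"
  shows "W i j 0 c \<in> L"
  using assms(5) unfolding commutator_span_def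
proof (induction rule: span_induct)
  case base
  show ?case
    using W_add_in_L[of i j 0 _ 0] W_scale_in_L[of i j 0]
    by (auto simp: subspace_def W_zero_in_L)
next
  case (step c)
  then obtain f a where c: "c = f * a - a * f" by blast
  have *: "W i j 0 (scale (\<epsilon> i j) (f * a - a * f)) \<in> L"
    using W_0_mult_in_L[OF ij, of f]
  proof
    assume "\<forall>a b. W i j a b \<in> L \<longrightarrow> W i j (f * a) (b * f) \<in> L"
    then have "W i j (f * a) (scale (- \<epsilon> i j) a * f) \<in> L"
      using W_antisym_in_L[OF ij(1,2)] by blast
    from W_add_in_L[OF this W_antisym_in_L[OF ij(1,2), of "- (f * a)"]]
    show ?thesis by (simp add: scale_mult_left scale_right_diff_distrib)
  next
    assume "\<forall>a b. W i j a b \<in> L \<longrightarrow> W i j (a * f) (f * b) \<in> L"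
    then have "W i j (a * f) (f * scale (- \<epsilon> i j) a) \<in> L"
      using W_antisym_in_L[OF ij(1,2)] by blast
    from W_add_in_L[OF W_scale_in_L[OF this, of "-1"] W_antisym_in_L[OF ij(1,2), of "a * f"]]
    show ?thesis by (simp add: scale_mult_right scale_right_diff_distrib)
  qed
  show ?case
    using W_scale_in_L[OF *, of "\<epsilon> i j"] ij by (simp add: c eps_sq)
qed

lemma W_0_I1_in_L:
  assumes ij: "i < n" "j < n" "i \<noteq> j" "j \<noteq> r i" and "c \<in> I1 scale"
  shows "W i j 0 c \<in> L"
  using assms(5) unfolding I1_def
proof (induction rule: span_induct)
  case base
  show ?case
    using W_add_in_L[of i j 0 _ 0] W_scale_in_L[of i j 0]
    by (auto simp: subspace_def W_zero_in_L)
next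
  case (step x)
  then obtain f c where x: "x = f * c" and c: "c \<in> commutator_span scale" by blast
  have "W i j 0 c \<in> L"
    by (rule W_0_commutator_span_in_L[OF ij c])
  then consider "W i j (f * 0) (c * f) \<in> L" | "W i j (0 * f) (f * c) \<in> L"
    using W_0_mult_in_L[OF ij, of f] by blast
  then show ?case
  proof cases
    \<comment> \<open>Right multiplication gives \<open>c * f\<close>; adding the commutator of
      \<open>f\<close> and \<open>c\<close> corrects it to \<open>f * c\<close>.\<close>
    case 1
    then show ?thesis
      using W_add_in_L[OF 1 W_0_commutator_span_in_L[OF ij commutator_in_commutator_span[of f c]]]
      by (simp add: x)
  qed (simp add: x)
qed

section \<open>Diagonal conjugation preserves \<open>L\<close>\<close>

text \<open>This is the conjugate of a generator. It differs from the antisymmetric \<open>W\<close>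
  with first entry \<open>?a\<close> only by a multiple of \<open>?a - ?b\<close> in second
  place.\<close>

lemma W_conj_in_L:
  assumes de: "\<And>i. i < n \<Longrightarrow> d i * e i = 1" and ed: "\<And>i. i < n \<Longrightarrow> e i * d i = 1"
    and dd: "\<And>i j. i < n \<Longrightarrow> j < n \<Longrightarrow> d i * d (r i) \<simeq> d j * d (r j)"
    and ij: "i < n" "j < n"
  shows "W i j (d i * g * e j) (scale (- \<epsilon> i j) (d (r j) * g * e (r i))) \<in> L"
proof -
  let ?a = "d i * g * e j" and ?b = "d (r j) * g * e (r i)"
  have E: "W i j x (scale (- \<epsilon> i j) x) \<in> L" for x
    by (rule W_antisym_in_L[OF ij])
  have "W i j 0 (scale (\<epsilon> i j) (?a - ?b)) \<in> L"
  proof -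
    consider "j = r i" | "i = j" "i \<noteq> r i" | "i \<noteq> j" "j \<noteq> r i"
      by blast
    then show ?thesis
    proof cases
      case 1
      then show ?thesis
        using ij by (simp add: W_zero_in_L)
    next
      case 2
      \<comment> \<open>The difference is the commutator of \<open>d k\<close> and
        \<open>g * e k\<close>.\<close>
      have inner: "d k * g * e k - g \<in> commutator_span scale" if "k < n" for k
        using commutator_in_commutator_span[of "d k" "g * e k"] ed[OF that] by (simp add: mult.assoc)
      \<comment> \<open>Half the difference: \<open>W\<close> with entries \<open>?c\<close>,
        \<open>?c\<close> plus the antisymmetric one with \<open>- ?c\<close>, \<open>?c\<close>
        gives \<open>0\<close> and twice \<open>?c\<close>.\<close>
      let ?c = "scale (1/2) (?a - ?b)"
      have "?a - ?b \<in> commutator_span scale"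
        using subspace_diff[OF commutator_span_subspace inner[OF ij(1)] inner[of "r i"]] ij 2 by simp
      then have "?c \<in> commutator_span scale"
        by (rule subspace_scale[OF commutator_span_subspace])
      then have "W i j ?c ?c \<in> L"
        using W_commutator_span_in_L[OF ij(1)] 2 by simp
      from W_add_in_L[OF this E[of "- ?c"]] have "W i j 0 (?c + ?c) \<in> L"
        using 2 ij by (simp add: s_sq)
      moreover have "?c + ?c = ?a - ?b"
        unfolding scale_left_distrib[symmetric] by simp
      ultimately show ?thesis
        using 2 ij by (simp add: s_sq)
    next
      case 3
      \<comment> \<open>Inserting \<open>d (r i) * e (r i)\<close> exposes the product
        \<open>d i * d (r i)\<close>, to which \<open>dd\<close> applies.\<close>
      have "?a = d i * (d (r i) * e (r i)) * g * e j"
        using de[of "r i"] ij by simp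
      also have "\<dots> = (d i * d (r i)) * (e (r i) * (g * e j))"
        by (simp add: mult.assoc)
      also have "\<dots> \<simeq> (d (r j) * d j) * ((e j * g) * e (r i))"
      proof (rule I1_cong_mult)
        show "d i * d (r i) \<simeq> d (r j) * d j"
          using dd[of i "r j"] ij by simp
        show "e (r i) * (g * e j) \<simeq> (e j * g) * e (r i)"
          by (rule I1_cong_trans[OF I1_cong_comm I1_cong_mult[OF I1_cong_comm I1_cong_refl]])
      qed
      also have "(d (r j) * d j) * ((e j * g) * e (r i)) = d (r j) * (d j * e j) * g * e (r i)"
        by (simp add: mult.assoc)
      also have "\<dots> = ?b"
        using de[of j] ij by simp
      finally have "?a - ?b \<in> I1 scale"
        by (simp add: I1_cong_def)
      then show ?thesis
        by (intro W_0_I1_in_L ij 3 subspace_scale I1_subspace)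
    qed
  qed
  from W_add_in_L[OF E[of ?a] this] show ?thesis
    by (simp add: scale_right_diff_distrib)
qed

text \<open>Position \<open>(p,q)\<close> is met twice: as first entry for \<open>t = (p,q)\<close>
  and as second entry for \<open>t = (r q, r p)\<close>.\<close>

lemma sum_W:
  assumes Y: "Y \<in> carrier_mat n n"
  shows "mat n n (\<lambda>p. \<Sum>t\<in>{..<n} \<times> {..<n}. W (fst t) (snd t) (Y $$ t) (Y $$ (r (snd t), r (fst t))) $$ p)
    = Y + Y"
proof (rule eq_matI)
  fix p q assume "p < dim_row (Y + Y)" "q < dim_col (Y + Y)"
  then have pq: "p < n" "q < n" using Y by auto
  let ?S = "{..<n} \<times> {..<n}"
  have "(\<Sum>t\<in>?S. W (fst t) (snd t) (Y $$ t) (Y $$ (r (snd t), r (fst t))) $$ (p,q))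
    = (\<Sum>t\<in>?S. (if t = (p,q) then Y $$ t else 0)
        + (if t = (r q, r p) then Y $$ (r (snd t), r (fst t)) else 0))"
  proof (rule sum.cong)
    fix t assume "t \<in> ?S"
    then have t: "fst t < n" "snd t < n" by auto
    have 1: "p = fst t \<and> q = snd t \<longleftrightarrow> t = (p,q)"
      by (auto simp: prod_eq_iff)
    have 2: "p = r (snd t) \<and> q = r (fst t) \<longleftrightarrow> t = (r q, r p)"
      unfolding opp_eq_iff[OF pq(1) t(2)] opp_eq_iff[OF pq(2) t(1)] prod_eq_iff by auto
    show "W (fst t) (snd t) (Y $$ t) (Y $$ (r (snd t), r (fst t))) $$ (p,q)
      = (if t = (p,q) then Y $$ t else 0)
        + (if t = (r q, r p) then Y $$ (r (snd t), r (fst t)) else 0)"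
      unfolding W_def index_mat(1)[OF pq] prod.case 1 2 ..
  qed simp
  also have "\<dots> = Y $$ (p,q) + Y $$ (p,q)"
    using pq by (simp add: sum.distrib)
  finally show "mat n n (\<lambda>p. \<Sum>t\<in>?S. W (fst t) (snd t) (Y $$ t) (Y $$ (r (snd t), r (fst t))) $$ p) $$ (p,q)
    = (Y + Y) $$ (p,q)"
    using pq Y by simp
qed (use Y in auto)

lemma conj_pure_tensor_in_L:
  assumes de: "\<And>i. i < n \<Longrightarrow> d i * e i = 1" and ed: "\<And>i. i < n \<Longrightarrow> e i * d i = 1"
    and dd: "\<And>i j. i < n \<Longrightarrow> j < n \<Longrightarrow> d i * d (r i) \<simeq> d j * d (r j)"
    and M: "M \<in> \<oo>"
  shows "mat_diag n d * pure_tensor scale g M * mat_diag n e \<in> L"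
proof -
  let ?Y = "mat_diag n d * pure_tensor scale g M * mat_diag n e"
  have Mc: "M \<in> carrier_mat n n"
    using M o_carrier by blast
  have Y: "?Y = mat n n (\<lambda>(i,j). d i * scale (M $$ (i,j)) g * e j)"
    using Mc by (subst mat_diag_conj) (auto simp: pure_tensor_def)
  then have Yc: "?Y \<in> carrier_mat n n" by simp
  \<comment> \<open>Antisymmetry of \<open>M\<close> makes each opposite pair of entries a
    conjugated generator with \<open>g\<close> scaled by \<open>M $$ (i,j)\<close>.\<close>
  have "W i j (?Y $$ (i,j)) (?Y $$ (r j, r i)) \<in> L" if ij: "i < n" "j < n" for i j
  proof -
    have "M $$ (r j, r i) = - \<epsilon> i j * M $$ (i,j)"
      using mem_o_iff[THEN iffD1, OF M, THEN conjunct2, rule_format, of "r j" "r i"] ij eps_opp[OF ij]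
      by simp
    then have "?Y $$ (r j, r i) = scale (- \<epsilon> i j) (d (r j) * scale (M $$ (i,j)) g * e (r i))"
      using ij by (simp add: Y scale_mult_left scale_mult_right)
    moreover have "?Y $$ (i,j) = d i * scale (M $$ (i,j)) g * e j"
      using ij by (simp add: Y)
    ultimately show ?thesis
      using W_conj_in_L[where d = d and e = e, OF de ed dd ij] by simp
  qed
  then have "mat n n (\<lambda>p. \<Sum>t\<in>{..<n} \<times> {..<n}.
      W (fst t) (snd t) (?Y $$ t) (?Y $$ (r (snd t), r (fst t))) $$ p) \<in> L"
    by (intro mat_subspace_sum[OF L_subspace]) auto
  then have "?Y + ?Y \<in> L"
    unfolding sum_W[OF Yc] .
  then have "map_mat (scale (1/2)) (?Y + ?Y) \<in> L"
    using L_subspace unfolding mat_subspace_def by blast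
  moreover have "map_mat (scale (1/2)) (?Y + ?Y) = ?Y"
    using Yc by (intro eq_matI) (auto simp: scale_right_distrib scale_left_distrib[symmetric])
  ultimately show ?thesis by simp
qed

section \<open>Antisymmetry modulo \<open>I1\<close> and the criterion for diagonal matrices\<close>

lemma L_subset_antisym_mod_I1:
  "L \<subseteq> {X \<in> carrier_mat n n. \<forall>i<n. \<forall>j<n. X $$ (i,j) \<simeq> scale (- \<epsilon> i j) (X $$ (r j, r i))}"
    (is "_ \<subseteq> ?P")
proof (rule lie_gA_least)
  \<comment> \<open>The signs of the two factors cancel, and commuting entries modulo
    \<open>I1\<close> reverses the product. Subtracting the case with \<open>X\<close> and
    \<open>Y\<close> exchanged gives closure under brackets.\<close>
  have mult: "(X * Y) $$ (i,j) \<simeq> scale (\<epsilon> i j) ((Y * X) $$ (r j, r i))"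
    if X: "X \<in> ?P" and Y: "Y \<in> ?P" and ij: "i < n" "j < n" for X Y i j
  proof -
    have "(X * Y) $$ (i,j) = (\<Sum>k<n. X $$ (i,k) * Y $$ (k,j))"
      using X Y ij by (simp add: index_mult_mat_sum)
    also have "\<dots> \<simeq> (\<Sum>k<n. scale (\<epsilon> i j) (Y $$ (r j, r k) * X $$ (r k, r i)))"
    proof (rule I1_cong_sum)
      fix k assume "k \<in> {..<n}"
      then have k: "k < n" by simp
      have "X $$ (i,k) * Y $$ (k,j)
        \<simeq> scale (- \<epsilon> i k) (X $$ (r k, r i)) * scale (- \<epsilon> k j) (Y $$ (r j, r k))"
        using X Y ij k by (intro I1_cong_mult) auto
      also have "\<dots> = scale (\<epsilon> i j) (X $$ (r k, r i) * Y $$ (r j, r k))"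
      proof -
        have "- \<epsilon> i k * - \<epsilon> k j = \<epsilon> i j * (s k * s k)" by simp
        then show ?thesis
          using k by (simp only: scale_times s_sq) simp
      qed
      also have "\<dots> \<simeq> scale (\<epsilon> i j) (Y $$ (r j, r k) * X $$ (r k, r i))"
        by (intro I1_cong_scale I1_cong_comm)
      finally show "X $$ (i,k) * Y $$ (k,j) \<simeq> scale (\<epsilon> i j) (Y $$ (r j, r k) * X $$ (r k, r i))" .
    qed
    also have "(\<Sum>k<n. scale (\<epsilon> i j) (Y $$ (r j, r k) * X $$ (r k, r i)))
      = (\<Sum>k<n. scale (\<epsilon> i j) (Y $$ (r j, k) * X $$ (k, r i)))"
      by (rule sum_opp)
    also have "\<dots> = scale (\<epsilon> i j) ((Y * X) $$ (r j, r i))"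
      using X Y ij by (subst index_mult_mat_sum[of Y n X]) (simp_all add: scale_sum_right)
    finally show ?thesis .
  qed
  show "mat_lie_subalgebra scale n ?P"
    unfolding mat_lie_subalgebra_def mat_subspace_def
  proof (intro conjI ballI allI)
    fix X Y assume X: "X \<in> ?P" and Y: "Y \<in> ?P"
    show "X + Y \<in> ?P"
    proof (intro CollectI conjI allI impI)
      fix i j assume ij: "i < n" "j < n"
      have "X $$ (i,j) + Y $$ (i,j)
        \<simeq> scale (- \<epsilon> i j) (X $$ (r j, r i)) + scale (- \<epsilon> i j) (Y $$ (r j, r i))"
        using X Y ij by (intro I1_cong_add) auto
      then show "(X + Y) $$ (i,j) \<simeq> scale (- \<epsilon> i j) ((X + Y) $$ (r j, r i))"
        using X Y ij by (auto simp: scale_right_distrib)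
    qed (use X Y in auto)
    show "X * Y - Y * X \<in> ?P"
    proof (intro CollectI conjI allI impI)
      fix i j assume ij: "i < n" "j < n"
      from I1_cong_diff[OF mult[OF X Y ij] mult[OF Y X ij]]
      show "(X * Y - Y * X) $$ (i,j) \<simeq> scale (- \<epsilon> i j) ((X * Y - Y * X) $$ (r j, r i))"
        using X Y ij by (auto simp: scale_right_diff_distrib simp del: index_mult_mat(1))
    qed (use X Y in \<open>auto simp: minus_carrier_mat\<close>)
  next
    fix c X assume X: "X \<in> ?P"
    show "map_mat (scale c) X \<in> ?P"
    proof (intro CollectI conjI allI impI)
      fix i j assume ij: "i < n" "j < n"
      then have "scale c (X $$ (i,j)) \<simeq> scale c (scale (- \<epsilon> i j) (X $$ (r j, r i)))"
        using X by (intro I1_cong_scale) auto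
      then show "map_mat (scale c) X $$ (i,j) \<simeq> scale (- \<epsilon> i j) (map_mat (scale c) X $$ (r j, r i))"
        using X ij by (auto simp: ac_simps)
    qed (use X in auto)
  qed auto
next
  fix g M assume M: "M \<in> \<oo>"
  then have Mc: "M \<in> carrier_mat n n"
    using o_carrier by blast
  show "pure_tensor scale g M \<in> ?P"
  proof (intro CollectI conjI allI impI)
    fix i j assume ij: "i < n" "j < n"
    have "M $$ (i,j) = - \<epsilon> i j * M $$ (r j, r i)"
      using mem_o_iff[THEN iffD1, OF M, THEN conjunct2, rule_format, OF ij] by simp
    then have "scale (M $$ (i,j)) g = scale (- \<epsilon> i j) (scale (M $$ (r j, r i)) g)"
      by simp
    then show "pure_tensor scale g M $$ (i,j) \<simeq> scale (- \<epsilon> i j) (pure_tensor scale g M $$ (r j, r i))"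
      using Mc ij by (simp add: pure_tensor_def)
  qed (use Mc in \<open>auto simp: pure_tensor_def\<close>)
qed

lemma L_antisym_mod_I1:
  "X \<in> L \<Longrightarrow> i < n \<Longrightarrow> j < n \<Longrightarrow> X $$ (i,j) \<simeq> scale (- \<epsilon> i j) (X $$ (r j, r i))"
  using L_subset_antisym_mod_I1 by blast

lemma mat_diag_mem_G_gA_iff:
  assumes "mat_diag n d \<in> GL n"
  shows "mat_diag n d \<in> G_gA scale n \<oo> \<longleftrightarrow> (\<forall>i<n. \<forall>j<n. d i * d (r i) \<simeq> d j * d (r j))"
proof
  assume "mat_diag n d \<in> G_gA scale n \<oo>"
  then obtain h where inv: "mutually_inverse n (mat_diag n d) h"
    and im: "(\<lambda>X. mat_diag n d * X * h) ` L = L"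
    by (auto simp: G_gA_def)
  from inv obtain e where h: "h = mat_diag n e" and "\<forall>i<n. d i * e i = 1 \<and> e i * d i = 1"
    by (rule mutually_inverse_mat_diagE)
  then have de: "d i * e i = 1" and ed: "e i * d i = 1" if "i < n" for i
    using that by blast+
  show "\<forall>i<n. \<forall>j<n. d i * d (r i) \<simeq> d j * d (r j)"
  proof (intro allI impI)
    fix i j assume ij: "i < n" "j < n"
    show "d i * d (r i) \<simeq> d j * d (r j)"
    proof (cases "j = r i")
      case True
      then show ?thesis
        using ij by (simp add: I1_cong_comm)
    next
      case False
      let ?X = "W i j 1 (scale (- \<epsilon> i j) 1)"
      let ?Y = "mat_diag n d * ?X * mat_diag n e"
      have "?Y \<in> (\<lambda>X. mat_diag n d * X * h) ` L"
        unfolding h by (rule imageI[OF W_antisym_in_L[OF ij]])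
      then have "?Y \<in> L"
        unfolding im .
      then have "?Y $$ (i,j) \<simeq> scale (- \<epsilon> i j) (?Y $$ (r j, r i))"
        using ij by (rule L_antisym_mod_I1)
      moreover have "?X $$ (i,j) = 1"
        using ij False by (simp add: W_def)
      then have "?Y $$ (i,j) = d i * e j"
        using ij by (simp add: mat_diag_conj[OF W_carrier])
      moreover have "?X $$ (r j, r i) = scale (- \<epsilon> i j) 1"
        using ij False by (simp add: W_def)
      then have "?Y $$ (r j, r i) = scale (- \<epsilon> i j) (d (r j) * e (r i))"
        using ij by (simp add: mat_diag_conj[OF W_carrier] scale_mult_left scale_mult_right)
      ultimately have de_cong: "d i * e j \<simeq> d (r j) * e (r i)"
        using ij by (simp add: eps_sq)
      \<comment> \<open>Multiplying \<open>de_cong\<close> by \<open>d j * d (r i)\<close> clears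
        the inverses.\<close>
      have "d i * d (r i) = d i * (e j * d j) * d (r i)"
        using ed ij by simp
      also have "\<dots> = (d i * e j) * (d j * d (r i))"
        by (simp add: mult.assoc)
      also have "\<dots> \<simeq> (d (r j) * e (r i)) * (d (r i) * d j)"
        by (rule I1_cong_mult[OF de_cong I1_cong_comm])
      also have "(d (r j) * e (r i)) * (d (r i) * d j) = d (r j) * (e (r i) * d (r i)) * d j"
        by (simp add: mult.assoc)
      also have "\<dots> = d (r j) * d j"
        using ed ij by simp
      also have "\<dots> \<simeq> d j * d (r j)"
        by (rule I1_cong_comm)
      finally show ?thesis .
    qed
  qed
next
  assume "\<forall>i<n. \<forall>j<n. d i * d (r i) \<simeq> d j * d (r j)"
  then have dd: "d i * d (r i) \<simeq> d j * d (r j)" if "i < n" "j < n" for i j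
    using that by blast
  from assms obtain h where inv: "mutually_inverse n (mat_diag n d) h"
    by (auto simp: GL_def)
  then obtain e where h: "h = mat_diag n e" and "\<forall>i<n. d i * e i = 1 \<and> e i * d i = 1"
    by (rule mutually_inverse_mat_diagE)
  then have de: "d i * e i = 1" and ed: "e i * d i = 1" if "i < n" for i
    using that by blast+
  have inv': "mutually_inverse n (mat_diag n d) (mat_diag n e)"
    "mutually_inverse n (mat_diag n e) (mat_diag n d)"
    using inv by (auto simp: h mutually_inverse_def)
  \<comment> \<open>The inverse diagonal satisfies the same congruences, so its conjugation also
    maps \<open>L\<close> into itself; this yields surjectivity.\<close>
  have ee: "e i * e (r i) \<simeq> e j * e (r j)" if ij: "i < n" "j < n" for i j
  proof -
    have "e i * e (r i) = e i * e (r i) * (d (r j) * (d j * e j) * e (r j))"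
      using de ij by simp
    also have "\<dots> = (e i * e (r i)) * (d (r j) * d (r (r j))) * (e j * e (r j))"
      using ij by (simp add: mult.assoc)
    also have "\<dots> \<simeq> (e i * e (r i)) * (d (r i) * d (r (r i))) * (e j * e (r j))"
      using ij by (intro I1_cong_mult dd I1_cong_refl) simp_all
    also have "\<dots> = e i * (e (r i) * d (r i)) * d i * (e j * e (r j))"
      using ij by (simp add: mult.assoc)
    also have "\<dots> = e j * e (r j)"
      using ed ij by simp
    finally show ?thesis .
  qed
  have sub: "(\<lambda>X. mat_diag n d * X * mat_diag n e) ` L \<subseteq> L"
    by (intro conj_lie_gA_subset o_carrier inv' conj_pure_tensor_in_L de ed dd)
  have sub': "(\<lambda>X. mat_diag n e * X * mat_diag n d) ` L \<subseteq> L"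
    by (intro conj_lie_gA_subset o_carrier inv' conj_pure_tensor_in_L de ed ee)
  have "X \<in> (\<lambda>X. mat_diag n d * X * mat_diag n e) ` L" if X: "X \<in> L" for X
  proof
    have Xc: "X \<in> carrier_mat n n"
      using X L_subspace by (auto simp: mat_subspace_def)
    have cancel: "d i * (e i * x * d j) * e j = x" if "i < n" "j < n" for i j x
    proof -
      have "d i * (e i * x * d j) * e j = (d i * e i) * x * (d j * e j)"
        by (simp only: mult.assoc)
      then show ?thesis
        using de that by simp
    qed
    show "X = mat_diag n d * (mat_diag n e * X * mat_diag n d) * mat_diag n e"
      unfolding mat_diag_conj[OF Xc] using Xc
      by (subst mat_diag_conj) (auto simp: cancel)
    show "mat_diag n e * X * mat_diag n d \<in> L"
      using sub' X by blast
  qed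
  with sub have "(\<lambda>X. mat_diag n d * X * mat_diag n e) ` L = L"
    by blast
  then show "mat_diag n d \<in> G_gA scale n \<oo>"
    unfolding G_gA_def using assms inv'(1) by blast
qed

end

section \<open>Specialisation to the two given forms\<close>

lemma signed_antidiag_form_cases:
  fixes \<gg> :: "'k::field mat set"
  assumes "\<gg> = lie_o n (Phi0 n) \<or> (\<exists>m. n = 2 * m \<and> \<gg> = lie_o n (Phi1 m))"
  obtains s where "\<gg> = lie_o n (antidiag_form n s)"
    and "\<forall>i<n. s i * s i = 1" "\<forall>i<n. \<forall>j<n. s (opp n i) * s (opp n j) = s i * s j"
  using assms
proof
  assume "\<gg> = lie_o n (Phi0 n)"
  then show ?thesis
    by (intro that[of "\<lambda>_. 1"]) (simp_all add: Phi0_eq_antidiag_form)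
next
  assume "\<exists>m. n = 2 * m \<and> \<gg> = lie_o n (Phi1 m)"
  then obtain m where m: "n = 2 * m" "\<gg> = lie_o n (Phi1 m)" by blast
  \<comment> \<open>Opposite indices lie in different halves, so all signs of \<open>Phi1\<close>
    flip.\<close>
  have "opp n i < m \<longleftrightarrow> \<not> i < m" if "i < n" for i
    using that m(1) by (auto simp: opp_def)
  then show ?thesis
    by (intro that[of "\<lambda>i. if i < m then 1 else - 1"]) (auto simp: Phi1_eq_antidiag_form m)
qed

theorem proposition5p11:
  fixes scale :: "'k::field_char_0 \<Rightarrow> 'f::{ring,monoid_mult} \<Rightarrow> 'f"
    and n :: nat and \<gg> :: "'k mat set" and f :: "nat \<Rightarrow> 'f"
  defines "D \<equiv> mat_diag n (\<lambda>j. f (j + 1))"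
  assumes "unital_assoc_algebra scale"
    and "\<gg> = lie_o n (Phi0 n) \<or> (\<exists>m. n = 2 * m \<and> \<gg> = lie_o n (Phi1 m))"
    and "D \<in> GL n"
  shows "D \<in> G_gA scale n \<gg> \<longleftrightarrow> (\<forall>i \<in> {1..n}. f i * f (n - i + 1) - f 1 * f n \<in> I1 scale)"
proof -
  interpret unital_assoc_algebra scale by fact
  from assms(3) obtain s where \<gg>: "\<gg> = lie_o n (antidiag_form n s)"
    and s: "\<forall>i<n. s i * s i = 1" "\<forall>i<n. \<forall>j<n. s (opp n i) * s (opp n j) = s i * s j"
    by (rule signed_antidiag_form_cases)
  interpret signed_antidiag scale n s
    by unfold_locales (use s in blast)+
  let ?p = "\<lambda>i. f (i + 1) * f (opp n i + 1)"
  have p: "I1_cong (?p i) (?p 0) \<longleftrightarrow> f (i + 1) * f (n - (i + 1) + 1) - f 1 * f n \<in> I1 scale"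
    if "i < n" for i
  proof -
    \<comment> \<open>The reference product \<open>?p 0\<close> is \<open>f 1 * f n\<close> only for
      positive \<open>n\<close>, which \<open>i < n\<close> ensures.\<close>
    have "Suc (n - Suc 0) = n" using that by simp
    then show ?thesis by (simp add: I1_cong_def opp_def)
  qed
  have "D \<in> G_gA scale n \<gg> \<longleftrightarrow> (\<forall>i<n. \<forall>j<n. I1_cong (?p i) (?p j))"
    using mat_diag_mem_G_gA_iff[of "\<lambda>j. f (j + 1)"] assms(4) unfolding D_def \<gg> by blast
  also have "\<dots> \<longleftrightarrow> (\<forall>i<n. I1_cong (?p i) (?p 0))"
  proof (intro iffI allI impI)
    fix i assume "\<forall>i<n. \<forall>j<n. I1_cong (?p i) (?p j)" "i < n"
    moreover from \<open>i < n\<close> have "0 < n" by simp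
    ultimately show "I1_cong (?p i) (?p 0)" by blast
  next
    fix i j assume *: "\<forall>i<n. I1_cong (?p i) (?p 0)" and ij: "i < n" "j < n"
    from * ij have "I1_cong (?p i) (?p 0)" by blast
    moreover from * ij have "I1_cong (?p 0) (?p j)" by (blast intro: I1_cong_sym)
    ultimately show "I1_cong (?p i) (?p j)" by (rule I1_cong_trans)
  qed
  also have "\<dots> \<longleftrightarrow> (\<forall>i<n. f (i + 1) * f (n - (i + 1) + 1) - f 1 * f n \<in> I1 scale)"
    using p by blast
  also have "\<dots> \<longleftrightarrow> (\<forall>i \<in> {1..n}. f i * f (n - i + 1) - f 1 * f n \<in> I1 scale)"
  proof -
    have "{1..n} = (\<lambda>i. i + 1) ` {..<n}"
      by (simp add: image_Suc_lessThan)
    then show ?thesis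
      by (simp only: ball_simps lessThan_iff Ball_def[of "{..<n}"])
  qed
  finally show ?thesis .
qed

end
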